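(* For every integer $m\ge 3$, the graph $\mathrm{NU}_m(2)$ is not triply transitive.
   Context: Let $V=\mathbb F_4^m$ carry a non-degenerate Hermitian form $f$. $\mathrm{NU}_m(2)$ is the graph whose vertices are the non-isotropic $1$-dimensional subspaces of $V$, two distinct such points being adjacent iff the line (2-space) joining them is a tangent line, i.e. the restriction of $f$ to it is degenerate. For a strongly regular graph $\Gamma=(W,E)$: $A_0=I$, $A_1$ its adjacency matrix, $A_2=J-I-A_1$; for a vertex $\omega$, $E^*_{i,\omega}$ ($i=0,1,2$) is the diagonal matrix whose diagonal is the $\omega$-row of $A_i$; $T_\omega$ is the algebra generated by $A_0,A_1,A_2,E^*_{0,\omega},E^*_{1,\omega},E^*_{2,\omega}$; $T_{0,\omega}$ is the span of all $E^*_{i,\omega}A_jE^*_{k,\omega}$; $\tilde T_\omega$ is the algebra of complex matrices commuting with the permutation matrices of the stabilizer $G_\omega$ in $G=\mathrm{Aut}(\Gamma)$. $\Gamma$ is triply transitive if $G$ is transitive and $T_{0,\omega}=T_\omega=\tilde T_\omega$ for some (equivalently every) vertex $\omega$.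
   Formalization: "Strongly regular", required for triply transitive, here excludes imprimitive graphs (0<μ<k<v-1). NU_3(2)=K_{3,3,3,3} has T_0=T=T~, so the claim fails at m=3 if they are allowed; here m=3 holds only because the graph is then not strongly regular. m≥4 is unaffected. *)

theory Defs
  imports
    "HOL-Analysis.Analysis"
    "HOL-Library.Function_Algebras"
    "HOL-Combinatorics.Permutations"
begin

section \<open>Strongly regular graphs\<close>

text \<open>A graph is given by its vertex set \<open>W\<close> and its (symmetric, irreflexive) adjacency
  relation \<open>R\<close>.\<close>

definition simple_graph :: "'v set \<Rightarrow> 'v rel \<Rightarrow> bool" where
  "simple_graph W R \<longleftrightarrow> finite W \<and> R \<subseteq> W \<times> W \<and> sym R \<and> irrefl R"

text \<open>We use the convention that the trivial cases are not called strongly regular: neither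
  complete nor edgeless graphs, nor disjoint unions of complete graphs of equal size
  (\<open>\<mu> = 0\<close>), nor their complements, the complete multipartite graphs with parts of equal size
  (\<open>\<mu> = k\<close>). Equivalently, the graph and its complement are both connected (primitivity).
  The convention matters below: \<open>NU\<^sub>3(2)\<close> is the complete multipartite graph with four parts of
  size three, whose full automorphism group is transitive and satisfies
  \<open>T\<^sub>0 = T = \<close> centralizer algebra.\<close>

definition strongly_regular :: "'v set \<Rightarrow> 'v rel \<Rightarrow> bool" where
  "strongly_regular W R \<longleftrightarrow> simple_graph W R \<and>
     (\<exists>k l \<mu>. 0 < \<mu> \<and> \<mu> < k \<and> k < card W - 1 \<and>
        (\<forall>x\<in>W. card {z\<in>W. (x, z) \<in> R} = k) \<and>
        (\<forall>x\<in>W. \<forall>y\<in>W. (x, y) \<in> R \<longrightarrow>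
            card {z\<in>W. (x, z) \<in> R \<and> (y, z) \<in> R} = l) \<and>
        (\<forall>x\<in>W. \<forall>y\<in>W. x \<noteq> y \<and> (x, y) \<notin> R \<longrightarrow>
            card {z\<in>W. (x, z) \<in> R \<and> (y, z) \<in> R} = \<mu>))"

definition graph_aut :: "'v set \<Rightarrow> 'v rel \<Rightarrow> ('v \<Rightarrow> 'v) set" where
  "graph_aut W R =
     {g. g permutes W \<and> (\<forall>x\<in>W. \<forall>y\<in>W. (g x, g y) \<in> R \<longleftrightarrow> (x, y) \<in> R)}"


section \<open>Complex matrices indexed by a vertex set\<close>

text \<open>Matrices with rows and columns indexed by \<open>W\<close> are functions of two arguments that vanish
  outside \<open>W \<times> W\<close>; addition and zero are pointwise. Note that \<open>*\<close> on functions is the entrywise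
  product; the matrix product is \<open>mat_mult W\<close>.\<close>

type_synonym 'v cmat = "'v \<Rightarrow> 'v \<Rightarrow> complex"

definition mats :: "'v set \<Rightarrow> 'v cmat set" where
  "mats W = {A. \<forall>x y. x \<notin> W \<or> y \<notin> W \<longrightarrow> A x y = 0}"

definition mat_scale :: "complex \<Rightarrow> 'v cmat \<Rightarrow> 'v cmat" where
  "mat_scale c A = (\<lambda>x y. c * A x y)"

definition mat_mult :: "'v set \<Rightarrow> 'v cmat \<Rightarrow> 'v cmat \<Rightarrow> 'v cmat" where
  "mat_mult W A B = (\<lambda>x y. \<Sum>z\<in>W. A x z * B z y)"

global_interpretation cmat: vector_space "mat_scale :: complex \<Rightarrow> 'v cmat \<Rightarrow> 'v cmat"
  by unfold_locales (auto simp: mat_scale_def fun_eq_iff algebra_simps)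

definition id_mat :: "'v set \<Rightarrow> 'v cmat" where
  "id_mat W = (\<lambda>x y. if x \<in> W \<and> x = y then 1 else 0)"

definition all_one_mat :: "'v set \<Rightarrow> 'v cmat" where
  "all_one_mat W = (\<lambda>x y. if x \<in> W \<and> y \<in> W then 1 else 0)"

definition adj_mat :: "'v set \<Rightarrow> 'v rel \<Rightarrow> 'v cmat" where
  "adj_mat W R = (\<lambda>x y. if x \<in> W \<and> y \<in> W \<and> (x, y) \<in> R then 1 else 0)"

definition perm_mat :: "'v set \<Rightarrow> ('v \<Rightarrow> 'v) \<Rightarrow> 'v cmat" where
  "perm_mat W g = (\<lambda>x y. if x \<in> W \<and> y \<in> W \<and> g x = y then 1 else 0)"

text \<open>The subalgebra generated by a set of matrices. It is not required to contain the identity,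
  which is among the generators of the Terwilliger algebra anyway.\<close>

definition alg_gen :: "'v set \<Rightarrow> 'v cmat set \<Rightarrow> 'v cmat set" where
  "alg_gen W S = (\<lambda>T. cmat.subspace T \<and> (\<forall>A\<in>T. \<forall>B\<in>T. mat_mult W A B \<in> T)) hull S"


section \<open>Terwilliger algebras and triple transitivity\<close>

text \<open>The matrices \<open>A\<^sub>0, A\<^sub>1, A\<^sub>2\<close>; only the indices \<open>i \<le> 2\<close> are used.\<close>

definition rel_mat :: "'v set \<Rightarrow> 'v rel \<Rightarrow> nat \<Rightarrow> 'v cmat" where
  "rel_mat W R i =
     (if i = 0 then id_mat W
      else if i = 1 then adj_mat W R
      else all_one_mat W - id_mat W - adj_mat W R)"

definition dual_idem :: "'v set \<Rightarrow> 'v rel \<Rightarrow> 'v \<Rightarrow> nat \<Rightarrow> 'v cmat" where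
  "dual_idem W R \<omega> i = (\<lambda>x y. if x = y then rel_mat W R i \<omega> x else 0)"

definition terwilliger :: "'v set \<Rightarrow> 'v rel \<Rightarrow> 'v \<Rightarrow> 'v cmat set" where
  "terwilliger W R \<omega> = alg_gen W (rel_mat W R ` {0..2} \<union> dual_idem W R \<omega> ` {0..2})"

definition terwilliger0 :: "'v set \<Rightarrow> 'v rel \<Rightarrow> 'v \<Rightarrow> 'v cmat set" where
  "terwilliger0 W R \<omega> = cmat.span
     {mat_mult W (mat_mult W (dual_idem W R \<omega> i) (rel_mat W R j)) (dual_idem W R \<omega> k) |
       i j k. i \<in> {0..2} \<and> j \<in> {0..2} \<and> k \<in> {0..2}}"

definition terwilliger_tilde :: "'v set \<Rightarrow> 'v rel \<Rightarrow> 'v \<Rightarrow> 'v cmat set" where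
  "terwilliger_tilde W R \<omega> =
     {M \<in> mats W. \<forall>g\<in>graph_aut W R. g \<omega> = \<omega> \<longrightarrow>
        mat_mult W M (perm_mat W g) = mat_mult W (perm_mat W g) M}"

definition triply_transitive :: "'v set \<Rightarrow> 'v rel \<Rightarrow> bool" where
  "triply_transitive W R \<longleftrightarrow>
     strongly_regular W R \<and>
     (\<forall>x\<in>W. \<forall>y\<in>W. \<exists>g\<in>graph_aut W R. g x = y) \<and>
     (\<exists>\<omega>\<in>W. terwilliger0 W R \<omega> = terwilliger W R \<omega> \<and>
            terwilliger W R \<omega> = terwilliger_tilde W R \<omega>)"


section \<open>Hermitian forms over the field of order four and the graphs \<open>NU\<^sub>m(2)\<close>\<close>

text \<open>The field \<open>'a\<close> is meant to have exactly four elements; its non-trivial automorphism is then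
  \<open>a \<mapsto> a\<^sup>2\<close>. Semilinearity in the second argument follows.\<close>

definition hermitian_form :: "('a::field ^ 'm \<Rightarrow> 'a ^ 'm \<Rightarrow> 'a) \<Rightarrow> bool" where
  "hermitian_form f \<longleftrightarrow>
     (\<forall>u v w. f (u + v) w = f u w + f v w) \<and>
     (\<forall>c u w. f (c *s u) w = c * f u w) \<and>
     (\<forall>u w. f w u = (f u w)\<^sup>2)"

definition degenerate_on :: "('a::field ^ 'm \<Rightarrow> 'a ^ 'm \<Rightarrow> 'a) \<Rightarrow> ('a ^ 'm) set \<Rightarrow> bool" where
  "degenerate_on f U \<longleftrightarrow> (\<exists>u\<in>U. u \<noteq> 0 \<and> (\<forall>v\<in>U. f u v = 0))"

definition NU_verts :: "('a::field ^ 'm \<Rightarrow> 'a ^ 'm \<Rightarrow> 'a) \<Rightarrow> ('a ^ 'm) set set" where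
  "NU_verts f = {p. vec.subspace p \<and> vec.dim p = 1 \<and> (\<forall>v\<in>p. v \<noteq> 0 \<longrightarrow> f v v \<noteq> 0)}"

definition NU_adj :: "('a::field ^ 'm \<Rightarrow> 'a ^ 'm \<Rightarrow> 'a) \<Rightarrow> ('a ^ 'm) set rel" where
  "NU_adj f = {(p, q). p \<in> NU_verts f \<and> q \<in> NU_verts f \<and> p \<noteq> q \<and>
     degenerate_on f (vec.span (p \<union> q))}"

end

theory Submission
  imports Defs
begin

text \<open>Non-isotropic points are spanned by vectors of norm 1, and two distinct ones are
  non-adjacent iff they are orthogonal. For \<open>m = 3\<close>, with an orthonormal basis
  \<open>e\<^sub>1, e\<^sub>2, e\<^sub>3\<close>, every neighbour of \<open>\<langle>e\<^sub>1\<rangle>\<close> is a neighbour of \<open>\<langle>e\<^sub>2\<rangle>\<close>, so \<open>\<mu> = k\<close>. For \<open>m \<ge> 4\<close>, extend the unit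
  vector \<open>w\<close> spanning \<open>\<omega>\<close> by orthonormal \<open>a, b, d\<close> in \<open>w\<^sup>\<bottom>\<close>, put \<open>n = a + b\<close> and let \<open>c\<close> generate the
  multiplicative group of the field. The triangles spanned by \<open>w, w + n, w + c n\<close> (on a tangent
  line) and \<open>w, w + n, w + a + c b\<close> (spanning a non-degenerate 3-space) have different numbers of
  common non-neighbours: those of the second are among those of the first, but \<open>\<langle>d + n\<rangle>\<close> is one
  of the first only. These numbers are entries of \<open>E\<^sup>*\<^sub>1 A\<^sub>2 E\<^sup>*\<^sub>2 A\<^sub>2 E\<^sup>*\<^sub>1\<close>, which lies in \<open>T\<close>
  but then not in \<open>T\<^sub>0\<close>.\<close>

section \<open>Terwilliger algebras\<close>

lemma alg_gen_superset: "S \<subseteq> alg_gen W S"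
  unfolding alg_gen_def by (rule hull_subset)

lemma mat_mult_in_alg_gen:
  assumes "A \<in> alg_gen W S" and "B \<in> alg_gen W S"
  shows "mat_mult W A B \<in> alg_gen W S"
  using assms unfolding alg_gen_def hull_def by blast

lemma mat_mult_diag_left:
  assumes "finite W" "x \<in> W"
  shows "mat_mult W (dual_idem W R \<omega> i) A x y = rel_mat W R i \<omega> x * A x y"
proof -
  have "mat_mult W (dual_idem W R \<omega> i) A x y
      = (\<Sum>z\<in>W. if z = x then rel_mat W R i \<omega> x * A x y else 0)"
    unfolding mat_mult_def dual_idem_def by (rule sum.cong) auto
  then show ?thesis using assms by simp
qed

lemma mat_mult_diag_right:
  assumes "finite W" "y \<in> W"
  shows "mat_mult W A (dual_idem W R \<omega> i) x y = A x y * rel_mat W R i \<omega> y"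
proof -
  have "mat_mult W A (dual_idem W R \<omega> i) x y
      = (\<Sum>z\<in>W. if z = y then A x y * rel_mat W R i \<omega> y else 0)"
    unfolding mat_mult_def dual_idem_def by (rule sum.cong) auto
  then show ?thesis using assms by simp
qed

lemma rel_mat_2:
  assumes "x \<in> W" "y \<in> W" "irrefl R"
  shows "rel_mat W R 2 x y = (if x \<noteq> y \<and> (x, y) \<notin> R then 1 else 0)"
  using assms by (auto simp: rel_mat_def all_one_mat_def id_mat_def adj_mat_def irrefl_def)

text \<open>A generator E*_i A_j E*_k has at \<open>(x, y)\<close> the product of the entries of A_i
  at \<open>(\<omega>, x)\<close>, A_j at \<open>(x, y)\<close> and A_k at
  \<open>(\<omega>, y)\<close>. It sees only the relations among the three vertices, and so does
  every linear combination.\<close>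

lemma terwilliger0_entries_eq:
  assumes "finite W" "x \<in> W" "y \<in> W" "y' \<in> W"
    and "\<And>i. i \<in> {0..2} \<Longrightarrow> rel_mat W R i x y = rel_mat W R i x y'"
    and "\<And>i. i \<in> {0..2} \<Longrightarrow> rel_mat W R i \<omega> y = rel_mat W R i \<omega> y'"
    and "M \<in> terwilliger0 W R \<omega>"
  shows "M x y = M x y'"
  using assms(7) unfolding terwilliger0_def
proof (induction rule: cmat.span_induct)
  case base
  show ?case
    by (rule cmat.subspaceI) (auto simp: mat_scale_def)
next
  case (step M)
  then show ?case
    using assms(1-6) by (auto simp: mat_mult_diag_left mat_mult_diag_right)
qed

text \<open>The equality \<open>T\<close> turns closure under products into a regularity condition:
  all triangles on the edge \<open>(\<omega>, x)\<close> have equally many common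
  non-neighbours.\<close>

lemma card_common_non_neighbours_eq:
  fixes R :: "'v rel"
  defines "N \<equiv> \<lambda>x y. x \<noteq> y \<and> (x, y) \<notin> R"
  assumes graph: "simple_graph W R" and T: "terwilliger0 W R \<omega> = terwilliger W R \<omega>"
    and W: "\<omega> \<in> W" "x \<in> W" "y \<in> W" "y' \<in> W"
    and R: "(\<omega>, x) \<in> R" "(\<omega>, y) \<in> R" "(\<omega>, y') \<in> R" "(x, y) \<in> R" "(x, y') \<in> R"
  shows "card {z \<in> W. N \<omega> z \<and> N x z \<and> N z y} = card {z \<in> W. N \<omega> z \<and> N x z \<and> N z y'}"
proof -
  have fin: "finite W" and irr: "irrefl R"
    using graph by (auto simp: simple_graph_def)
  define E A where "E = dual_idem W R \<omega>" and "A = rel_mat W R"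
  \<comment> \<open>The inner \<open>E 2\<close> keeps the summation vertices \<open>z\<close> with
    \<open>N \<omega> z\<close>, and the two factors \<open>A 2\<close> impose \<open>N\<close>
    relative to row and column; the outer \<open>E 1\<close> act as 1 on neighbours of
    \<open>\<omega>\<close>.\<close>
  define M where
    "M = mat_mult W (E 1) (mat_mult W (mat_mult W (mat_mult W (A 2) (E 2)) (A 2)) (E 1))"
  have "A ` {0..2} \<union> E ` {0..2} \<subseteq> terwilliger W R \<omega>"
    unfolding terwilliger_def E_def A_def by (rule alg_gen_superset)
  then have gens: "A i \<in> terwilliger W R \<omega>" "E i \<in> terwilliger W R \<omega>" if "i \<in> {0..2}" for i
    using that by blast+
  have "M \<in> terwilliger0 W R \<omega>"
    unfolding T M_def terwilliger_def
    by (intro mat_mult_in_alg_gen gens[unfolded terwilliger_def]) simp_all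
  moreover have "x \<noteq> y" "x \<noteq> y'" "\<omega> \<noteq> y" "\<omega> \<noteq> y'"
    using R irr unfolding irrefl_def by blast+
  then have "rel_mat W R i x y = rel_mat W R i x y'"
    and "rel_mat W R i \<omega> y = rel_mat W R i \<omega> y'" for i
    using R W by (simp_all add: rel_mat_def all_one_mat_def id_mat_def adj_mat_def)
  ultimately have eq: "M x y = M x y'"
    using terwilliger0_entries_eq[OF fin W(2-4)] by blast
  have entry: "M x v = of_nat (card {z \<in> W. N \<omega> z \<and> N x z \<and> N z v})"
    if v: "v \<in> W" "(\<omega>, v) \<in> R" for v
  proof -
    have one: "rel_mat W R 1 \<omega> x = 1" "rel_mat W R 1 \<omega> v = 1"
      using W R v by (auto simp: rel_mat_def adj_mat_def)
    have "M x v = mat_mult W (mat_mult W (A 2) (E 2)) (A 2) x v"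
      unfolding M_def E_def using fin W v one
      by (simp add: mat_mult_diag_left mat_mult_diag_right)
    also have "\<dots> = (\<Sum>z\<in>W. A 2 x z * A 2 \<omega> z * A 2 z v)"
      unfolding mat_mult_def[of W "mat_mult W (A 2) (E 2)" "A 2"] unfolding E_def A_def
      by (intro sum.cong refl) (simp add: mat_mult_diag_right fin)
    also have "\<dots> = (\<Sum>z\<in>W. if N \<omega> z \<and> N x z \<and> N z v then 1 else 0)"
      using W v by (intro sum.cong refl) (simp add: A_def N_def rel_mat_2[OF _ _ irr])
    finally show ?thesis
      using fin by (simp add: sum.If_cases Int_def)
  qed
  show ?thesis
    using eq entry[OF W(3) R(2)] entry[OF W(4) R(3)] by simp
qed

section \<open>Hermitian forms over the field of order four\<close>

locale F4_hermitian =
  fixes f :: "'a::field ^ 'm \<Rightarrow> 'a ^ 'm \<Rightarrow> 'a"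
  assumes card_field: "CARD('a) = 4"
    and hermitian: "hermitian_form f"
    and nondegenerate: "\<not> degenerate_on f UNIV"
begin

section \<open>Arithmetic in the field of order four\<close>

lemma finite_field: "finite (UNIV :: 'a set)"
  using card_field by (intro card_ge_0_finite) simp

text \<open>Translation by 1 permutes the field, so summing over it gives 4 = 0; as 4 = 2 * 2 and
  there are no zero divisors, 2 = 0.\<close>

lemma char_two: "(1::'a) + 1 = 0"
proof -
  have "(\<Sum>x\<in>(UNIV::'a set). x + 1) = (\<Sum>x\<in>UNIV. x)"
    by (rule sum.reindex_bij_witness[of _ "\<lambda>x. x - 1" "\<lambda>x. x + 1"]) auto
  then have "(of_nat 4 :: 'a) = 0"
    by (simp add: sum.distrib card_field)
  moreover have "(of_nat 4 :: 'a) = (1 + 1) * (1 + 1)"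
    by simp
  ultimately have "((1::'a) + 1) * (1 + 1) = 0" by metis
  then show ?thesis by (simp only: mult_eq_0_iff disj_absorb)
qed

lemma add_self [simp]: "x + x = (0::'a)"
  using char_two by (metis distrib_left mult.right_neutral mult_zero_right)

text \<open>The arithmetic simprocs collect \<open>x + x\<close> into \<open>2 * x\<close>, hence these two rules.\<close>

lemma numeral_Bit0_eq_0 [simp]: "numeral (Num.Bit0 k) = (0::'a)"
  by (subst numeral_Bit0) (rule add_self)

lemma numeral_Bit1_eq_1 [simp]: "numeral (Num.Bit1 k) = (1::'a)"
  by (subst numeral_Bit1) (simp only: add_self add_0)

lemma add_self_vec [simp]: "x + x = (0 :: 'a ^ 'm)"
  by (simp add: vec_eq_iff)

lemma add_self_left [simp]: "x + (x + y) = (y::'a)"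
  by (simp add: add.assoc[symmetric])

lemma uminus_eq [simp]: "- x = (x::'a)"
  by (metis add_self neg_eq_iff_add_eq_0)

lemma diff_eq_add [simp]: "x - y = x + (y::'a)"
  by (metis diff_conv_add_uminus uminus_eq)

lemma diff_eq_add_vec [simp]: "x - y = x + (y:: 'a ^ 'm)"
  by (simp add: vec_eq_iff)

lemma add_eq_0_iff_eq: "x + y = 0 \<longleftrightarrow> x = (y::'a)"
  by (metis add_self add_right_cancel)

lemma add_eq_0_iff_eq_vec: "x + y = 0 \<longleftrightarrow> x = (y :: 'a ^ 'm)"
  by (metis add_self_vec add_right_cancel)

text \<open>Multiplication by \<open>x\<close> permutes the three nonzero elements, so their product
  is unchanged by the factor \<open>x ^ 3\<close>.\<close>

lemma power3_eq_1: "x ^ 3 = 1" if "x \<noteq> (0::'a)"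
proof -
  have "(\<Prod>y\<in>UNIV - {0::'a}. x * y) = (\<Prod>y\<in>UNIV - {0}. y)"
    by (rule prod.reindex_bij_witness[of _ "\<lambda>y. y / x" "\<lambda>y. x * y"]) (use that in auto)
  moreover have "card (UNIV - {0::'a}) = 3"
    using card_field by (simp add: card_Diff_singleton_if)
  moreover have "(\<Prod>y\<in>UNIV - {0::'a}. y) \<noteq> 0"
    using finite_field by simp
  ultimately show ?thesis
    by (simp add: prod.distrib)
qed

lemma square_add: "(x + y)\<^sup>2 = x\<^sup>2 + (y::'a)\<^sup>2"
proof -
  have "(x + y)\<^sup>2 = x\<^sup>2 + y\<^sup>2 + (x * y + x * y)"
    by (simp add: power2_eq_square algebra_simps del: add_self add_self_left)
  then show ?thesis by simp
qed

lemma obtain_generator: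
  obtains c :: 'a where "c \<noteq> 0" "c \<noteq> 1" "c\<^sup>2 = c + 1"
proof -
  have "UNIV - {0, 1 :: 'a} \<noteq> {}"
  proof
    assume "UNIV - {0, 1 :: 'a} = {}"
    then have "(UNIV :: 'a set) = {0, 1}" by auto
    then have "CARD('a) = card {0, 1 :: 'a}" by simp
    then show False using card_field by simp
  qed
  then obtain c :: 'a where c: "c \<noteq> 0" "c \<noteq> 1" by auto
  \<comment> \<open>This is the factorization of \<open>c ^ 3 - 1\<close>, with the cross terms that
    cancel in pairs.\<close>
  have "(c + 1) * (c\<^sup>2 + (c + 1)) = c ^ 3 + 1 + ((c\<^sup>2 + c\<^sup>2) + (c + c))"
    by (simp only: power2_eq_square power3_eq_cube distrib_left distrib_right
        mult_1_left mult_1_right ac_simps)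
  also have "\<dots> = 0" using power3_eq_1[OF c(1)] by simp
  finally have "c + 1 = 0 \<or> c\<^sup>2 + (c + 1) = 0" by simp
  then have "c\<^sup>2 = c + 1"
    using c(2) unfolding add_eq_0_iff_eq by blast
  then show thesis by (rule that[OF c])
qed

section \<open>Calculus of the Hermitian form\<close>

lemma form_add_left [simp]: "f (u + v) w = f u w + f v w"
  and form_scale_left [simp]: "f (k *s u) w = k * f u w"
  and form_conj: "f w u = (f u w)\<^sup>2"
  using hermitian unfolding hermitian_form_def by blast+

lemma form_add_right [simp]: "f w (u + v) = f w u + f w v"
  by (simp add: form_conj[of w] square_add)

lemma form_scale_right [simp]: "f w (k *s u) = k\<^sup>2 * f w u"
  by (simp add: form_conj[of w] power_mult_distrib)

lemma form_zero_left [simp]: "f 0 w = 0"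
  using form_scale_left[of 0 0 w] by simp

lemma form_zero_right [simp]: "f w 0 = 0"
  by (simp add: form_conj[of w 0])

lemma form_sum_left: "f (sum g B) w = (\<Sum>u\<in>B. f (g u) w)"
  by (induction B rule: infinite_finite_induct) auto

lemma form_eq_0_commute: "f u v = 0 \<longleftrightarrow> f v u = 0"
  by (simp add: form_conj[of v u])

text \<open>Conjugate symmetry makes \<open>f v v\<close> a fixed point of squaring, hence an
  element of the prime field.\<close>

lemma norm_cases: "f v v = 0 \<or> f v v = 1"
proof -
  have "f v v * f v v = f v v * 1"
    using form_conj[of v v] by (metis power2_eq_square mult_1_right)
  then show ?thesis
    by (metis mult_cancel_left)
qed

text \<open>Polarization: with \<open>t = f u v\<close>, the norm of \<open>u + k *s v\<close>
  reduces to \<open>k * t^2 + k^2 * t\<close>. Taking \<open>k = 1\<close> gives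
  \<open>t^2 = t\<close>; a generator \<open>c\<close> then gives
  \<open>(c + c^2) * t = t = 0\<close>.\<close>

lemma form_eq_0_if_norms_eq_0:
  assumes "\<And>k. f (u + k *s v) (u + k *s v) = 0" "f v v = 0"
  shows "f u v = 0"
proof (rule ccontr)
  assume nz: "f u v \<noteq> 0"
  obtain c :: 'a where c: "c \<noteq> 0" "c \<noteq> 1" "c\<^sup>2 = c + 1"
    by (rule obtain_generator)
  have "f u u = 0" using assms(1)[of 0] by simp
  then have *: "k * (f u v)\<^sup>2 + k\<^sup>2 * f u v = 0" for k
    using assms(1)[of k] assms(2) form_conj[of v u] by (simp add: algebra_simps)
  have sq: "(f u v)\<^sup>2 = f u v"
    using *[of 1] by (simp add: add_eq_0_iff_eq)
  have "(c + c\<^sup>2) * f u v = 0"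
    using *[of c] sq by (simp add: algebra_simps)
  then show False using c nz by simp
qed

lemma form_eq_0_on_span:
  assumes "x \<in> vec.span B" "\<And>y. y \<in> B \<Longrightarrow> f u y = 0"
  shows "f u x = 0"
proof -
  have "vec.subspace {y. f u y = 0}" by (rule vec.subspaceI) auto
  then have "vec.span B \<subseteq> {y. f u y = 0}"
    using assms(2) by (intro vec.span_minimal) auto
  then show ?thesis using assms(1) by blast
qed

section \<open>Orthonormal sets and bases\<close>

definition orthonormal :: "('a ^ 'm) set \<Rightarrow> bool" where
  "orthonormal B \<longleftrightarrow> finite B \<and> (\<forall>u\<in>B. \<forall>v\<in>B. f u v = (if u = v then 1 else 0))"

lemma orthonormalD: "orthonormal B \<Longrightarrow> u \<in> B \<Longrightarrow> v \<in> B \<Longrightarrow> f u v = (if u = v then 1 else 0)"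
  by (simp add: orthonormal_def)

lemma orthonormal_independent:
  assumes "orthonormal B"
  shows "vec.independent B"
  unfolding vec.dependent_def
proof (rule notI, elim bexE)
  fix u assume u: "u \<in> B" "u \<in> vec.span (B - {u})"
  have "f u u = 0"
    by (rule form_eq_0_on_span[OF u(2)]) (use assms u(1) in \<open>auto simp: orthonormal_def\<close>)
  then show False using assms u(1) by (simp add: orthonormal_def)
qed

text \<open>The sum is the orthogonal projection of \<open>v\<close> to the span of
  \<open>B\<close>; in characteristic two, adding it is subtracting it.\<close>

lemma form_residual:
  assumes "orthonormal B" "u \<in> B"
  shows "f (v + (\<Sum>w\<in>B. f v w *s w)) u = 0"
proof -
  have "f (\<Sum>w\<in>B. f v w *s w) u = (\<Sum>w\<in>B. if w = u then f v u else 0)"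
    using assms unfolding form_sum_left by (intro sum.cong) (auto simp: orthonormal_def)
  then show ?thesis using assms by (simp add: orthonormal_def)
qed

lemma orthonormal_insert:
  assumes "orthonormal B" "f e e = 1" "\<forall>u\<in>B. f e u = 0"
  shows "e \<notin> B \<and> orthonormal (insert e B)"
proof
  show "e \<notin> B" using assms(2,3) by force
  moreover have "\<forall>u\<in>B. f u e = 0" using assms(3) form_eq_0_commute by blast
  ultimately show "orthonormal (insert e B)"
    using assms by (auto simp: orthonormal_def)
qed

lemma eq_0_if_form_eq_0: "(\<And>v. f u v = 0) \<Longrightarrow> u = 0"
  using nondegenerate by (auto simp: degenerate_on_def)

text \<open>Otherwise \<open>B\<^sup>\<bottom>\<close> contains only isotropic vectors, so \<open>f\<close> vanishes on it by polarization. Then the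
  component \<open>P v \<in> B\<^sup>\<bottom>\<close> of any \<open>v\<close> lies in the radical of \<open>f\<close>, whence \<open>B\<close> spans.\<close>

lemma orthonormal_extend:
  assumes B: "orthonormal B" and card: "card B < CARD('m)"
  shows "\<exists>e. e \<notin> B \<and> orthonormal (insert e B)"
proof (rule ccontr)
  define C where "C = {x. \<forall>u\<in>B. f x u = 0}"
  define P where "P v = v + (\<Sum>w\<in>B. f v w *s w)" for v
  assume "\<not> ?thesis"
  then have iso: "f x x = 0" if "x \<in> C" for x
    using norm_cases[of x] orthonormal_insert[OF B, of x] that unfolding C_def by blast
  have C: "f x y = 0" if "x \<in> C" "y \<in> C" for x y
    by (rule form_eq_0_if_norms_eq_0; rule iso) (use that in \<open>auto simp: C_def\<close>)
  have PC: "P v \<in> C" for v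
    using form_residual[OF B] unfolding P_def C_def by blast
  have "P v = 0" for v
  proof (rule eq_0_if_form_eq_0)
    fix x
    have "f (P v) (\<Sum>w\<in>B. f x w *s w) = 0"
      using PC[of v] by (subst form_eq_0_commute, unfold form_sum_left)
        (auto simp: C_def form_eq_0_commute intro!: sum.neutral)
    moreover have "f (P v) (P x) = 0" using C PC by blast
    ultimately show "f (P v) x = 0" by (simp add: P_def[of x])
  qed
  have "v \<in> vec.span B" for v
  proof -
    have "v = (v + (\<Sum>w\<in>B. f v w *s w)) + (\<Sum>w\<in>B. f v w *s w)"
      unfolding add.assoc by simp
    also have "\<dots> = (\<Sum>w\<in>B. f v w *s w)" using \<open>P v = 0\<close> by (simp add: P_def)
    finally show ?thesis
      by (metis (no_types, lifting) vec.span_sum vec.span_scale vec.span_base)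
  qed
  then have "vec.dim (UNIV :: ('a ^ 'm) set) \<le> card B"
    using B by (intro vec.dim_le_card) (auto simp: orthonormal_def)
  then show False using card by (simp add: vec.dim_UNIV card_cart_basis)
qed

lemma orthonormal_triple:
  assumes "f w w = 1" "CARD('m) \<ge> 3"
  obtains a b where "a \<noteq> w" "b \<noteq> w" "b \<noteq> a" "orthonormal {b, a, w}"
proof -
  have "orthonormal {w}" using assms(1) by (simp add: orthonormal_def)
  from orthonormal_extend[OF this] obtain a where "a \<noteq> w" "orthonormal {a, w}"
    using assms(2) by auto
  from orthonormal_extend[OF this(2)] this(1) that show thesis
    using assms(2) by auto
qed

text \<open>An orthonormal set of full size is a basis, so the residual \<open>p\<close> is
  orthogonal to the whole space and vanishes by non-degeneracy.\<close>

lemma orthonormal_expansion: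
  assumes B: "orthonormal B" and card: "card B = CARD('m)"
  shows "v = (\<Sum>w\<in>B. f v w *s w)"
proof -
  define p where "p = v + (\<Sum>w\<in>B. f v w *s w)"
  have span: "vec.span B = UNIV"
    using vec.card_ge_dim_independent[of B UNIV] orthonormal_independent[OF B] card
    by (auto simp: vec.dim_UNIV card_cart_basis)
  have "f p x = 0" for x
  proof -
    have "x \<in> vec.span B" using span by simp
    then show ?thesis
      by (rule form_eq_0_on_span) (use form_residual[OF B] in \<open>simp add: p_def\<close>)
  qed
  then have "p = 0" by (rule eq_0_if_form_eq_0)
  then show ?thesis
    unfolding p_def by (simp only: add_eq_0_iff_eq_vec)
qed

section \<open>The graph on the non-isotropic points\<close>

text \<open>Norms take only the values 0 and 1, so any generator of a non-isotropic point has norm 1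
  without rescaling.\<close>

lemma NU_verts_iff: "p \<in> NU_verts f \<longleftrightarrow> (\<exists>v. f v v = 1 \<and> p = vec.span {v})"
proof
  assume p: "p \<in> NU_verts f"
  then obtain B where B: "B \<subseteq> p" "vec.independent B" "p \<subseteq> vec.span B" "card B = vec.dim p"
    using vec.basis_exists by blast
  then obtain v where v: "B = {v}"
    using p by (auto simp: NU_verts_def card_1_singleton_iff)
  have "p = vec.span {v}"
    using B(1,3) v p by (intro equalityI vec.span_minimal) (auto simp: NU_verts_def)
  moreover have "v \<noteq> 0" using B(2) v by (auto simp: vec.dependent_zero)
  ultimately show "\<exists>v. f v v = 1 \<and> p = vec.span {v}"
    using p v B(1) norm_cases[of v] by (auto simp: NU_verts_def)
next
  assume "\<exists>v. f v v = 1 \<and> p = vec.span {v}"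
  then obtain v where v: "f v v = 1" "p = vec.span {v}" by blast
  then have "v \<noteq> 0" by auto
  then have "vec.dim p = 1"
    using v(2) vec.dim_span_eq_card_independent[of "{v}"] by simp
  moreover have "f x x \<noteq> 0" if "x \<in> p" "x \<noteq> 0" for x
    using that v by (auto simp: vec.span_singleton)
  ultimately show "p \<in> NU_verts f"
    using v by (simp add: NU_verts_def vec.subspace_span)
qed

lemma span_in_NU_verts: "f v v = 1 \<Longrightarrow> vec.span {v} \<in> NU_verts f"
  by (auto simp: NU_verts_iff)

text \<open>If \<open>u = k *s v\<close>, then \<open>k^2 * f u v = f u u = 1\<close>. Thus
  orthogonality of unit vectors already makes their points distinct, as used in
  \<open>NU_non_adj_iff\<close>.\<close>

lemma span_eq_imp_form_nonzero:
  assumes "f u u = 1" "vec.span {u} = vec.span {v}"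
  shows "f u v \<noteq> 0"
proof -
  have "u \<in> vec.span {v}" using assms(2) vec.span_base[of u "{u}"] by auto
  then obtain k where k: "u = k *s v" by (auto simp: vec.span_singleton)
  show ?thesis
    using assms(1) by (subst (asm) (2) k) auto
qed

text \<open>With \<open>t = f u v\<close>, the Gram determinant is \<open>1 - t ^ 3\<close>, which
  vanishes exactly for nonzero \<open>t\<close>.\<close>

lemma NU_adj_iff:
  assumes u: "f u u = 1" and v: "f v v = 1"
  shows "(vec.span {u}, vec.span {v}) \<in> NU_adj f
      \<longleftrightarrow> vec.span {u} \<noteq> vec.span {v} \<and> f u v \<noteq> 0"
proof -
  define t where "t = f u v"
  have span: "vec.span (vec.span {u} \<union> vec.span {v}) = vec.span {u, v}"
    unfolding vec.span_eq
    using vec.span_mono[of "{u}" "{u, v}"] vec.span_mono[of "{v}" "{u, v}"]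
      vec.span_base[of u "{u}"] vec.span_base[of v "{v}"]
    by (auto intro: vec.span_base)
  have "degenerate_on f (vec.span {u, v}) \<longleftrightarrow> t \<noteq> 0" if ne: "vec.span {u} \<noteq> vec.span {v}"
  proof
    assume "degenerate_on f (vec.span {u, v})"
    then obtain x where x: "x \<in> vec.span {u, v}" "x \<noteq> 0" "\<And>y. y \<in> vec.span {u, v} \<Longrightarrow> f x y = 0"
      by (auto simp: degenerate_on_def)
    have "f x u = 0" "f x v = 0" by (auto intro!: x(3) vec.span_base)
    obtain a where "x - a *s u \<in> vec.span {v}"
      using x(1) vec.span_breakdown_eq by blast
    then obtain b where "x + a *s u = b *s v" by (auto simp: vec.span_singleton)
    moreover have "x = a *s u + (x + a *s u)"
      by (simp add: add.left_commute[of "a *s u"])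
    ultimately have ab: "x = a *s u + b *s v" by simp
    show "t \<noteq> 0"
    proof
      assume "t = 0"
      then have "f u v = 0" "f v u = 0" by (auto simp: t_def form_eq_0_commute)
      then have "a = 0" "b = 0"
        using \<open>f x u = 0\<close> \<open>f x v = 0\<close> u v by (auto simp: ab)
      then show False using x(2) ab by simp
    qed
  next
    assume t: "t \<noteq> 0"
    \<comment> \<open>This vector lies in the radical: its product with \<open>v\<close> is
      \<open>t + t = 0\<close>, and with \<open>u\<close> it is
      \<open>1 + t ^ 3 = 0\<close>.\<close>
    define x where "x = u + t *s v"
    have nz: "x \<noteq> 0"
    proof
      assume "x = 0"
      then have eq: "u = t *s v"
        unfolding x_def by (simp only: add_eq_0_iff_eq_vec)
      then have "v = (1 / t) *s u" using t by (simp add: vec.scale_scale)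
      then have "u \<in> vec.span {v}" "v \<in> vec.span {u}"
        using eq unfolding vec.span_singleton by blast+
      then show False using ne by (auto simp: vec.span_eq)
    qed
    have "f x v = 0" using v by (simp add: x_def t_def)
    moreover have "f x u = 0"
      using power3_eq_1[OF t] u form_conj[of v u]
      by (simp add: x_def t_def power2_eq_square power3_eq_cube mult.assoc)
    ultimately have "f x y = 0" if "y \<in> vec.span {u, v}" for y
      using that by (auto intro: form_eq_0_on_span)
    moreover have "x \<in> vec.span {u, v}"
      unfolding x_def by (intro vec.span_add vec.span_scale vec.span_base) auto
    ultimately show "degenerate_on f (vec.span {u, v})"
      using nz by (auto simp: degenerate_on_def)
  qed
  then show ?thesis
    using span_in_NU_verts[OF u] span_in_NU_verts[OF v]
    by (auto simp: NU_adj_def span t_def)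
qed

lemma NU_non_adj_iff:
  assumes "f u u = 1" "f v v = 1"
  shows "vec.span {u} \<noteq> vec.span {v} \<and> (vec.span {u}, vec.span {v}) \<notin> NU_adj f \<longleftrightarrow> f u v = 0"
  using assms by (auto simp: NU_adj_iff dest: span_eq_imp_form_nonzero)

text \<open>The vector \<open>z\<close>, orthogonal to \<open>u\<close> but not to \<open>v\<close>,
  certifies that the two points differ.\<close>

lemma NU_adjI:
  assumes "f u u = 1" "f v v = 1" "f u v \<noteq> 0" "f u z = 0" "f v z \<noteq> 0"
  shows "(vec.span {u}, vec.span {v}) \<in> NU_adj f"
proof -
  have "v \<notin> vec.span {u}" using assms by (auto simp: vec.span_singleton)
  then have "vec.span {u} \<noteq> vec.span {v}" using vec.span_base[of v "{v}"] by auto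
  then show ?thesis using assms by (simp add: NU_adj_iff)
qed

section \<open>Dimension three\<close>

text \<open>In orthonormal coordinates the norm is the number of nonzero coordinates modulo two. A
  unit vector spanning a neighbour of the point of \<open>e1\<close> has nonzero
  \<open>e1\<close>-coordinate but is no multiple of \<open>e1\<close>, so all three coordinates are
  nonzero.\<close>

lemma dim_3_neighbours_subset:
  assumes "CARD('m) = 3"
  obtains p q where "p \<in> NU_verts f" "q \<in> NU_verts f" "p \<noteq> q" "(p, q) \<notin> NU_adj f"
    "\<forall>z\<in>NU_verts f. (p, z) \<in> NU_adj f \<longrightarrow> (q, z) \<in> NU_adj f"
proof -
  have "orthonormal {}" by (simp add: orthonormal_def)
  from orthonormal_extend[OF this] obtain e1 where "orthonormal {e1}"
    by auto
  then have "f e1 e1 = 1" by (simp add: orthonormal_def)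
  then obtain e2 e3 where ne: "e2 \<noteq> e1" "e3 \<noteq> e1" "e3 \<noteq> e2" and B: "orthonormal {e3, e2, e1}"
    by (rule orthonormal_triple) (use assms in simp_all)
  have e1: "f e1 e1 = 1" and e2: "f e2 e2 = 1" "f e2 e1 = 0" and e12: "f e1 e2 = 0"
    using ne ne[symmetric] by (simp_all add: orthonormalD[OF B])
  have B_card: "card {e3, e2, e1} = CARD('m)"
    using ne assms by simp
  have adj: "(vec.span {e2}, z) \<in> NU_adj f"
    if z: "z \<in> NU_verts f" "(vec.span {e1}, z) \<in> NU_adj f" for z
  proof -
    obtain v where v: "f v v = 1" "z = vec.span {v}" using z(1) by (auto simp: NU_verts_iff)
    have ev: "vec.span {e1} \<noteq> vec.span {v}" "f e1 v \<noteq> 0"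
      using z(2) v e1 by (auto simp: NU_adj_iff)
    have exp: "v = f v e3 *s e3 + (f v e2 *s e2 + f v e1 *s e1)"
      using orthonormal_expansion[OF B B_card, of v] ne by simp
    have cube: "x * x\<^sup>2 = (if x = 0 then 0 else 1)" for x :: 'a
      using power3_eq_1[of x] by (simp add: power2_eq_square power3_eq_cube mult.assoc)
    have "f v v = f v e3 * f e3 v + (f v e2 * f e2 v + f v e1 * f e1 v)"
      using arg_cong[OF exp, of "\<lambda>x. f x v"] by simp
    then have norm: "f v v = f v e3 * (f v e3)\<^sup>2 + (f v e2 * (f v e2)\<^sup>2 + f v e1 * (f v e1)\<^sup>2)"
      by (simp only: form_conj[of e1 v] form_conj[of e2 v] form_conj[of e3 v])
    have "f v e1 \<noteq> 0" using ev(2) form_eq_0_commute by blast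
    have "f v e2 \<noteq> 0"
    proof
      assume z2: "f v e2 = 0"
      then have "f v e3 = 0"
        using norm v(1) \<open>f v e1 \<noteq> 0\<close> unfolding cube by (auto split: if_splits)
      then have "v = f v e1 *s e1" using exp z2 by simp
      moreover then have "e1 = (1 / f v e1) *s v"
        using \<open>f v e1 \<noteq> 0\<close> by (metis nonzero_eq_divide_eq vec.scale_one vec.scale_scale)
      ultimately have "v \<in> vec.span {e1}" "e1 \<in> vec.span {v}"
        unfolding vec.span_singleton by blast+
      then show False using ev(1) by (auto simp: vec.span_eq)
    qed
    then have "f e2 v \<noteq> 0" using form_eq_0_commute by blast
    then show ?thesis
      using NU_adjI[of e2 v e1] v e2 \<open>f v e1 \<noteq> 0\<close> by simp
  qed
  have "vec.span {e1} \<noteq> vec.span {e2} \<and> (vec.span {e1}, vec.span {e2}) \<notin> NU_adj f"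
    using NU_non_adj_iff[OF e1 e2(1)] e12 by blast
  then show thesis
    using that span_in_NU_verts[OF e1] span_in_NU_verts[OF e2(1)] adj by blast
qed

lemma not_strongly_regular_dim_3:
  assumes "CARD('m) = 3"
  shows "\<not> strongly_regular (NU_verts f) (NU_adj f)"
proof
  assume "strongly_regular (NU_verts f) (NU_adj f)"
  then obtain k \<mu> where "\<mu> < k"
    and k: "\<forall>x\<in>NU_verts f. card {z\<in>NU_verts f. (x, z) \<in> NU_adj f} = k"
    and \<mu>: "\<forall>x\<in>NU_verts f. \<forall>y\<in>NU_verts f. x \<noteq> y \<and> (x, y) \<notin> NU_adj f \<longrightarrow>
      card {z\<in>NU_verts f. (x, z) \<in> NU_adj f \<and> (y, z) \<in> NU_adj f} = \<mu>"
    unfolding strongly_regular_def by (elim conjE exE) (rule that)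
  obtain p q where pq: "p \<in> NU_verts f" "q \<in> NU_verts f" "p \<noteq> q" "(p, q) \<notin> NU_adj f"
    and "\<forall>z\<in>NU_verts f. (p, z) \<in> NU_adj f \<longrightarrow> (q, z) \<in> NU_adj f"
    by (rule dim_3_neighbours_subset[OF assms])
  then have "{z\<in>NU_verts f. (p, z) \<in> NU_adj f \<and> (q, z) \<in> NU_adj f}
      = {z\<in>NU_verts f. (p, z) \<in> NU_adj f}"
    by blast
  moreover have "card {z\<in>NU_verts f. (p, z) \<in> NU_adj f} = k"
    using k pq(1) by blast
  moreover have "card {z\<in>NU_verts f. (p, z) \<in> NU_adj f \<and> (q, z) \<in> NU_adj f} = \<mu>"
    using \<mu> pq by blast
  ultimately have "\<mu> = k" by simp
  then show False using \<open>\<mu> < k\<close> by simp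
qed

section \<open>Dimension at least four\<close>

text \<open>The triangles share the points of \<open>w\<close> and \<open>x\<close> and differ only
  in the third, \<open>y\<close> or \<open>y'\<close>; the point of \<open>z\<close> tells them
  apart.\<close>

lemma inequivalent_triangles:
  assumes w: "f w w = 1" and dim: "CARD('m) \<ge> 4"
  obtains x y y' z where "f x x = 1" "f y y = 1" "f y' y' = 1" "f z z = 1"
    "(vec.span {w}, vec.span {x}) \<in> NU_adj f" "(vec.span {w}, vec.span {y}) \<in> NU_adj f"
    "(vec.span {w}, vec.span {y'}) \<in> NU_adj f" "(vec.span {x}, vec.span {y}) \<in> NU_adj f"
    "(vec.span {x}, vec.span {y'}) \<in> NU_adj f"
    "\<forall>v. f w v = 0 \<and> f x v = 0 \<longrightarrow> f v y = 0"
    "f w z = 0" "f x z = 0" "f z y' \<noteq> 0"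
proof -
  obtain a b where "a \<noteq> w" "b \<noteq> w" "b \<noteq> a" "orthonormal {b, a, w}"
    by (rule orthonormal_triple[OF w]) (use dim in simp_all)
  from orthonormal_extend[OF this(4)] this(1-3) obtain d
    where ne: "a \<noteq> w" "b \<noteq> w" "b \<noteq> a" "d \<noteq> w" "d \<noteq> a" "d \<noteq> b"
      and on: "orthonormal {d, b, a, w}"
    using dim by auto
  have form: "f w w = 1" "f w a = 0" "f w b = 0" "f w d = 0"
    "f a w = 0" "f a a = 1" "f a b = 0" "f a d = 0"
    "f b w = 0" "f b a = 0" "f b b = 1" "f b d = 0"
    "f d w = 0" "f d a = 0" "f d b = 0" "f d d = 1"
    using ne ne[symmetric] by (simp_all add: orthonormalD[OF on])
  obtain c :: 'a where c: "c \<noteq> 0" "c \<noteq> 1" "c\<^sup>2 = c + 1" by (rule obtain_generator)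
  have cc: "c * (c + 1) = 1"
    using power3_eq_1[OF c(1)] c(3) by (simp add: power3_eq_cube power2_eq_square mult.commute)
  have c1: "c + 1 \<noteq> 0" "1 + c \<noteq> 0"
    using c(2) by (auto simp: add_eq_0_iff_eq)
  \<comment> \<open>As \<open>n\<close> is isotropic and orthogonal to \<open>w\<close>, the two
    span a tangent line, which contains \<open>y = (1 + c) *s w + c *s x\<close>. In contrast,
    \<open>f n (a + c *s b) = 1 + c^2 = c\<close> is nonzero. Adding \<open>d\<close> to
    \<open>n\<close> gives \<open>z\<close> norm 1 without changing its products with
    \<open>w\<close>, \<open>x\<close>, \<open>y'\<close>.\<close>
  define n x y y' z where "n = a + b" and "x = w + n" and "y = w + c *s n"
    and "y' = w + (a + c *s b)" and "z = d + n"
  note defs = n_def x_def y_def y'_def z_def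
  have norms: "f x x = 1" "f y y = 1" "f y' y' = 1" "f z z = 1"
    by (simp_all add: defs form c algebra_simps) (use cc in \<open>simp_all add: algebra_simps\<close>)
  have wx: "(vec.span {w}, vec.span {x}) \<in> NU_adj f"
    by (rule NU_adjI[of _ _ a]) (simp_all add: norms form(1), simp_all add: defs form)
  have wy: "(vec.span {w}, vec.span {y}) \<in> NU_adj f"
    by (rule NU_adjI[of _ _ a]) (simp_all add: norms form(1), simp_all add: defs form c)
  have wy2: "(vec.span {w}, vec.span {y'}) \<in> NU_adj f"
    by (rule NU_adjI[of _ _ a]) (simp_all add: norms form(1), simp_all add: defs form c)
  \<comment> \<open>\<open>w + a\<close> is orthogonal to \<open>x\<close> because 1 + 1 = 0, but
    has product \<open>1 + c\<close> with \<open>y\<close>; \<open>w + b\<close> separates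
    \<open>x\<close> from \<open>y'\<close> in the same way.\<close>
  have xy: "(vec.span {x}, vec.span {y}) \<in> NU_adj f"
    by (rule NU_adjI[of _ _ "w + a"])
      (simp_all add: norms form(1), simp_all add: defs form c c1)
  have xy2: "(vec.span {x}, vec.span {y'}) \<in> NU_adj f"
    by (rule NU_adjI[of _ _ "w + b"])
      (simp_all add: norms form(1), simp_all add: defs form c c1)
  have y0: "\<forall>v. f w v = 0 \<and> f x v = 0 \<longrightarrow> f v y = 0"
  proof (intro allI impI)
    fix v assume v: "f w v = 0 \<and> f x v = 0"
    then have "f n v = 0" by (auto simp: x_def)
    then have "f v w = 0" "f v n = 0" using v form_eq_0_commute by blast+
    then show "f v y = 0" by (simp add: y_def)
  qed
  have z0: "f w z = 0" "f x z = 0" "f z y' \<noteq> 0"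
    by (simp_all add: defs form c)
  show thesis
    by (rule that[OF norms wx wy wy2 xy xy2 y0 z0])
qed

lemma terwilliger0_neq_terwilliger:
  assumes dim: "CARD('m) \<ge> 4" and graph: "simple_graph (NU_verts f) (NU_adj f)"
    and \<omega>: "\<omega> \<in> NU_verts f"
  shows "terwilliger0 (NU_verts f) (NU_adj f) \<omega> \<noteq> terwilliger (NU_verts f) (NU_adj f) \<omega>"
proof
  assume T: "terwilliger0 (NU_verts f) (NU_adj f) \<omega> = terwilliger (NU_verts f) (NU_adj f) \<omega>"
  obtain w where w: "f w w = 1" "\<omega> = vec.span {w}"
    using \<omega> by (auto simp: NU_verts_iff)
  obtain x y y' z where norms: "f x x = 1" "f y y = 1" "f y' y' = 1" "f z z = 1"
    and adj: "(vec.span {w}, vec.span {x}) \<in> NU_adj f" "(vec.span {w}, vec.span {y}) \<in> NU_adj f"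
      "(vec.span {w}, vec.span {y'}) \<in> NU_adj f" "(vec.span {x}, vec.span {y}) \<in> NU_adj f"
      "(vec.span {x}, vec.span {y'}) \<in> NU_adj f"
    and y: "\<forall>v. f w v = 0 \<and> f x v = 0 \<longrightarrow> f v y = 0"
    and z: "f w z = 0" "f x z = 0" "f z y' \<noteq> 0"
    by (rule inequivalent_triangles[OF w(1) dim])
  \<comment> \<open>The bracketed conjuncts have the form of \<open>NU_non_adj_iff\<close>, so
    membership becomes three orthogonality conditions on unit vectors.\<close>
  define S where "S u = {q \<in> NU_verts f. (\<omega> \<noteq> q \<and> (\<omega>, q) \<notin> NU_adj f) \<and>
    (vec.span {x} \<noteq> q \<and> (vec.span {x}, q) \<notin> NU_adj f) \<and>
    (q \<noteq> vec.span {u} \<and> (q, vec.span {u}) \<notin> NU_adj f)}" for u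
  have card_eq: "card (S y) = card (S y')"
    using card_common_non_neighbours_eq[OF graph T, of "vec.span {x}" "vec.span {y}" "vec.span {y'}"]
    unfolding S_def w(2) using w(1) norms adj by (simp only: span_in_NU_verts)
  have S_iff: "vec.span {v} \<in> S u \<longleftrightarrow> f w v = 0 \<and> f x v = 0 \<and> f v u = 0"
    if "f v v = 1" "f u u = 1" for u v
    using span_in_NU_verts[OF that(1)]
    by (simp only: S_def w(2) mem_Collect_eq NU_non_adj_iff[OF w(1) that(1)]
        NU_non_adj_iff[OF norms(1) that(1)] NU_non_adj_iff[OF that] simp_thms)
  have "S y' \<subseteq> S y"
  proof
    fix q assume q: "q \<in> S y'"
    then have "q \<in> NU_verts f" unfolding S_def by blast
    then obtain v where v: "f v v = 1" "q = vec.span {v}" unfolding NU_verts_iff by blast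
    then have v0: "f w v = 0" "f x v = 0"
      using q S_iff[OF v(1) norms(3)] by blast+
    then have "f v y = 0" using y by blast
    then show "q \<in> S y" using v0 v S_iff[OF v(1) norms(2)] by blast
  qed
  moreover have "vec.span {z} \<in> S y"
    using S_iff[OF norms(4) norms(2)] y z by blast
  moreover have "vec.span {z} \<notin> S y'"
    using S_iff[OF norms(4) norms(3)] z by blast
  moreover have "finite (S y)"
    using graph by (simp add: S_def simple_graph_def)
  ultimately show False
    using card_eq psubset_card_mono[of "S y" "S y'"] by (metis less_irrefl psubsetI)
qed

end

theorem theorem6p15:
  fixes f :: "'a::field ^ 'm \<Rightarrow> 'a ^ 'm \<Rightarrow> 'a"
  assumes "CARD('a) = 4"
    and "CARD('m) \<ge> 3"
    and "hermitian_form f"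
    and "\<not> degenerate_on f UNIV"
  shows "\<not> triply_transitive (NU_verts f) (NU_adj f)"
proof
  assume tt: "triply_transitive (NU_verts f) (NU_adj f)"
  have F4: "F4_hermitian f"
    by (rule F4_hermitian.intro[OF assms(1,3,4)])
  show False
  \<comment> \<open>In dimension three strong regularity itself fails; in higher dimension the
    equality of the two algebras, claimed at some vertex, is refuted at every vertex.\<close>
  proof (cases "CARD('m) = 3")
    case True
    then show ?thesis
      using tt F4_hermitian.not_strongly_regular_dim_3[OF F4]
      unfolding triply_transitive_def by blast
  next
    case False
    then have "CARD('m) \<ge> 4" using assms(2) by simp
    moreover have "simple_graph (NU_verts f) (NU_adj f)"
      using tt unfolding triply_transitive_def strongly_regular_def by (elim conjE)
    moreover obtain \<omega> where "\<omega> \<in> NU_verts f"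
      "terwilliger0 (NU_verts f) (NU_adj f) \<omega> = terwilliger (NU_verts f) (NU_adj f) \<omega>"
      using tt unfolding triply_transitive_def by blast
    ultimately show ?thesis
      using F4_hermitian.terwilliger0_neq_terwilliger[OF F4] by blast
  qed
qed

end
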